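(* Let $S=\langle a,a+k,a+2k,\ldots,a+(a-1)k\rangle$, where $a$ and $k$ are relatively prime positive integers. Let $d$ be a positive divisor of $a$, say $a=sd$. Then $$g(S/d)=\frac{F(S/d)+s-1}{2}.$$
   Context: $\mathbb{N}$ denotes the set of nonnegative integers. A numerical semigroup is a subset of $\mathbb{N}$ that is closed under addition, contains $0$, and has finite complement in $\mathbb{N}$. For positive integers $a_1,\ldots,a_n$ with $\gcd(a_1,\ldots,a_n)=1$, $\langle a_1,\ldots,a_n\rangle=\{c_1a_1+\cdots+c_na_n: c_1,\ldots,c_n\in\mathbb{N}\}$, which is a numerical semigroup. For a numerical semigroup $S$ and a positive integer $d$, the quotient of $S$ by $d$ is $S/d=\{x\in\mathbb{N}: dx\in S\}$, which is again a numerical semigroup. The Frobenius number and genus of a numerical semigroup $S$ are $F(S)=\max(\mathbb{N}\setminus S)$ and $g(S)=|\mathbb{N}\setminus S|$, respectively.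
   Formalization: The case d = a (s = 1) is excluded by assuming S/d is not all of ℕ: there S/d = ℕ, so F(S/d) is the maximum of an empty set, and with the usual convention F(ℕ) = −1 the formula would read 0 = −1/2. All other cases are covered. *)

theory Defs
  imports Complex_Main
begin

definition numerical_semigroup :: "nat set \<Rightarrow> bool" where
  "numerical_semigroup S \<longleftrightarrow>
     0 \<in> S \<and> (\<forall>x\<in>S. \<forall>y\<in>S. x + y \<in> S) \<and> finite (UNIV - S)"

text \<open>The generators are the \<open>n\<close> values \<open>g 0, \<dots>, g (n - 1)\<close>; the indexing starts at 0.\<close>

definition semigroup_gen :: "nat \<Rightarrow> (nat \<Rightarrow> nat) \<Rightarrow> nat set" where
  "semigroup_gen n g = {(\<Sum>i<n. c i * g i) | c :: nat \<Rightarrow> nat. True}"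

definition semigroup_quotient :: "nat set \<Rightarrow> nat \<Rightarrow> nat set" where
  "semigroup_quotient S d = {x. d * x \<in> S}"

text \<open>As a maximum, this is meaningful only if \<open>S\<close> has at least one gap:
  \<open>frobenius UNIV\<close> is an unspecified number (in particular it is not \<open>-1\<close>).\<close>

definition frobenius :: "nat set \<Rightarrow> nat" where
  "frobenius S = Max (UNIV - S)"

definition genus :: "nat set \<Rightarrow> nat" where
  "genus S = card (UNIV - S)"

text \<open>Quotients stay within numerical semigroups, where the gaps are finite in number
  and \<^const>\<open>genus\<close> is their true count.\<close>

lemma numerical_semigroup_quotient:
  assumes "numerical_semigroup S" and "d > 0"
  shows "numerical_semigroup (semigroup_quotient S d)"
proof -
  have "finite ((\<lambda>x. d * x) -` (UNIV - S))"
    using assms by (intro finite_vimageI) (auto simp: numerical_semigroup_def inj_on_def)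
  moreover have "(\<lambda>x. d * x) -` (UNIV - S) = UNIV - semigroup_quotient S d"
    by (auto simp: semigroup_quotient_def)
  ultimately show ?thesis
    using assms
    by (auto simp: numerical_semigroup_def semigroup_quotient_def distrib_left)
qed

end

theory Submission
  imports Defs "HOL-Number_Theory.Cong"
begin

text \<open>
  A sum of \<open>c\<close> generators \<open>a + i * k\<close> has the form \<open>c * a + j * k\<close> with \<open>j \<le> c * (a - 1)\<close>, and
  every such number occurs. Since multiples of \<open>a\<close> can be moved out of \<open>j\<close>, this means
  that the least element of \<open>S\<close> in the residue class of \<open>i * k\<close> modulo \<open>a\<close>, where \<open>0 < i < a\<close>,
  is \<open>a + i * k\<close>. Dividing by \<open>d\<close> keeps exactly the indices \<open>i\<close> that are multiples of \<open>d\<close>, as \<open>d\<close> is prime to \<open>k\<close>,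
  so \<open>S/d\<close> has the same shape with \<open>s\<close> in place of \<open>a\<close>
  (lemma \<open>mem_semigroup_quotient_arith_iff\<close>).

  The gaps of \<open>S/d\<close> are therefore the natural numbers \<open>i * k - m * s\<close> with \<open>0 < i < s\<close> and
  \<open>m \<ge> 0\<close>, each represented once (lemmas \<open>gaps_arith_eq\<close> and \<open>inj_on_gaps_arith\<close>). The largest is \<open>(s - 1) * k\<close>, and the genus is the sum of
  \<open>1 + (i * k) div s\<close> over \<open>0 < i < s\<close>. Pairing \<open>i\<close> with \<open>s - i\<close> and using that \<open>s\<close> does not
  divide \<open>i * k\<close>, twice this sum is \<open>(s - 1) * (k + 1)\<close>, which is \<open>(s - 1) * k + s - 1\<close>
  (lemma \<open>twice_sum_floor\<close>).
\<close>

lemma semigroup_gen_add_generator: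
  assumes "x \<in> semigroup_gen n g" and "t < n"
  shows "x + g t \<in> semigroup_gen n g"
proof -
  obtain c where c: "x = (\<Sum>i<n. c i * g i)"
    using assms(1) by (auto simp: semigroup_gen_def)
  have "(\<Sum>i<n. (c i + of_bool (i = t)) * g i) = x + (\<Sum>i<n. if i = t then g i else 0)"
    unfolding c sum.distrib [symmetric] by (rule sum.cong) auto
  also have "\<dots> = x + g t"
    using assms(2) by simp
  finally show ?thesis
    by (auto simp: semigroup_gen_def intro!: exI [of _ "\<lambda>i. c i + of_bool (i = t)"])
qed

lemma mem_semigroup_gen_arith_iff:
  assumes "a > 0"
  shows "n \<in> semigroup_gen a (\<lambda>i. a + i * k) \<longleftrightarrow> (\<exists>c j. j \<le> c * (a - 1) \<and> n = c * a + j * k)"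
    (is "n \<in> ?S \<longleftrightarrow> ?R")
proof
  assume "n \<in> ?S"
  then obtain f where f: "n = (\<Sum>i<a. f i * (a + i * k))"
    by (auto simp: semigroup_gen_def)
  have "n = (\<Sum>i<a. f i) * a + (\<Sum>i<a. f i * i) * k"
    unfolding f by (simp add: distrib_left sum.distrib sum_distrib_right mult.assoc)
  moreover have "(\<Sum>i<a. f i * i) \<le> (\<Sum>i<a. f i) * (a - 1)"
    unfolding sum_distrib_right by (intro sum_mono mult_le_mono) auto
  ultimately show ?R by blast
next
  have "c * a + j * k \<in> ?S" if "j \<le> c * (a - 1)" for c j
    using that
  proof (induction c arbitrary: j)
    case 0
    then show ?case
      by (auto simp: semigroup_gen_def intro!: exI [of _ "\<lambda>_. 0"])
  next
    case (Suc c)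
    \<comment> \<open>Greedy choice: the next generator takes as much of \<open>j\<close> as a single one can.\<close>
    define t where "t = min j (a - 1)"
    have "j - t \<le> c * (a - 1)"
      using Suc.prems by (auto simp: t_def min_def)
    then have "c * a + (j - t) * k + (a + t * k) \<in> ?S"
      using assms by (intro semigroup_gen_add_generator Suc.IH) (auto simp: t_def)
    moreover have "(j - t) * k + t * k = j * k"
      by (simp add: t_def add_mult_distrib [symmetric])
    then have "c * a + (j - t) * k + (a + t * k) = Suc c * a + j * k"
      by simp
    ultimately show ?case
      by (simp only:)
  qed
  then show "?R \<Longrightarrow> n \<in> ?S" by blast
qed

text \<open>
  If \<open>d * x = c * s * d + j * k\<close>, then \<open>d\<close> divides \<open>j\<close> because it is prime to \<open>k\<close>; so write
  \<open>j = d * l\<close> and reduce \<open>l\<close> modulo \<open>s\<close>, absorbing the quotient into \<open>c\<close>.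
\<close>

lemma mem_semigroup_quotient_arith_iff:
  assumes "a > 0" and "coprime a k" and "d > 0" and "a = s * d"
  shows "x \<in> semigroup_quotient (semigroup_gen a (\<lambda>i. a + i * k)) d
    \<longleftrightarrow> (\<exists>c i. i < s \<and> (i = 0 \<or> c > 0) \<and> x = c * s + i * k)" (is "?L \<longleftrightarrow> ?R")
proof
  assume ?L
  then obtain c j where cj: "j \<le> c * (a - 1)" "d * x = c * a + j * k"
    by (auto simp: semigroup_quotient_def mem_semigroup_gen_arith_iff [OF \<open>a > 0\<close>])
  have "d dvd c * a + j * k"
    using cj(2) by (metis dvd_triv_left)
  then have "d dvd j * k"
    using assms(4) by (simp add: dvd_add_right_iff)
  moreover have "coprime d k"
    using assms by simp
  ultimately obtain l where l: "j = d * l"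
    by (auto simp: coprime_dvd_mult_left_iff elim: dvdE)
  have "d * x = d * (c * s + l * k)"
    using cj(2) assms(4) l by (simp add: algebra_simps)
  then have "x = c * s + l * k"
    using \<open>d > 0\<close> by simp
  also have "\<dots> = c * s + (l div s * s + l mod s) * k"
    by simp
  also have "\<dots> = (c + l div s * k) * s + l mod s * k"
    by (simp only: algebra_simps)
  finally have "x = (c + l div s * k) * s + l mod s * k" .
  moreover have "l mod s = 0 \<or> c + l div s * k > 0"
    using cj(1) l \<open>d > 0\<close> by (cases "c = 0") auto
  moreover have "l mod s < s"
    using assms by simp
  ultimately show ?R
    by (intro exI [of _ "c + l div s * k"] exI [of _ "l mod s"] conjI)
next
  assume ?R
  then obtain c i where ci: "i < s" "i = 0 \<or> c > 0" "x = c * s + i * k"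
    by blast
  have "i * d \<le> c * (a - 1)"
  proof (cases "i = 0")
    case False
    have "i * d + 1 \<le> i * d + d"
      using \<open>d > 0\<close> by simp
    also have "\<dots> = Suc i * d"
      by simp
    also have "\<dots> \<le> s * d"
      using ci(1) by (intro mult_le_mono) auto
    finally have "i * d \<le> 1 * (a - 1)"
      using assms(4) by simp
    also have "\<dots> \<le> c * (a - 1)"
      using False ci(2) by (intro mult_le_mono) auto
    finally show ?thesis .
  qed simp
  moreover have "d * x = c * a + (i * d) * k"
    using ci(3) assms(4) by (simp add: algebra_simps)
  ultimately show ?L
    by (auto simp: semigroup_quotient_def mem_semigroup_gen_arith_iff [OF \<open>a > 0\<close>])
qed

lemma multiples_cong_cancel:
  fixes i j k s :: nat
  assumes "coprime s k" and "i < s" and "j < s" and "[i * k = j * k] (mod s)"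
  shows "i = j"
  using assms by (meson cong_less_modulus_unique_nat cong_mult_rcancel_nat coprime_commute)

lemma multiple_cong_exists:
  fixes k s x :: nat
  assumes "coprime s k" and "s > 0"
  obtains i where "i < s" and "[i * k = x] (mod s)"
proof -
  obtain y where "[k * y = 1] (mod s)"
    using cong_solve_coprime_nat [of k s] assms(1) by (auto simp: coprime_commute)
  then have "[x * (k * y) = x * 1] (mod s)"
    by (rule cong_scalar_left)
  then have "[(x * y) * k = x] (mod s)"
    by (simp add: ac_simps)
  then have "[(x * y) mod s * k = x] (mod s)"
    by (simp add: cong_def mod_mult_left_eq)
  with that [of "(x * y) mod s"] assms(2) show ?thesis by simp
qed

text \<open>
  As \<open>i\<close> runs through the residues modulo \<open>s\<close>, so does \<open>i * k\<close>. For \<open>i = 0\<close> the whole class lies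
  in the semigroup; for \<open>i > 0\<close> precisely the numbers above \<open>i * k\<close> do, so that \<open>i * k\<close> itself
  is still a gap.
\<close>

lemma gaps_arith_eq:
  fixes k s :: nat
  assumes "coprime s k" and "s > 0"
  shows "UNIV - {x. \<exists>c i. i < s \<and> (i = 0 \<or> c > 0) \<and> x = c * s + i * k}
    = (\<lambda>(i, m). i * k - m * s) ` (SIGMA i:{1..<s}. {..i * k div s})"
    (is "UNIV - ?T = ?f ` ?A")
proof (intro equalityI subsetI)
  fix x assume "x \<in> UNIV - ?T"
  then have gap: "\<not> (i < s \<and> (i = 0 \<or> c > 0) \<and> x = c * s + i * k)" for c i
    by blast
  obtain i where i: "i < s" "[i * k = x] (mod s)"
    using multiple_cong_exists [OF assms] .
  have le: "x \<le> i * k"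
  proof (rule ccontr)
    assume less: "\<not> x \<le> i * k"
    then have "s dvd x - i * k"
      using i(2) by (metis cong_altdef_nat cong_sym nat_le_linear)
    then obtain c where "x - i * k = c * s"
      by (metis dvdE mult.commute)
    with less have "x = c * s + i * k" "c > 0"
      by (auto intro!: Nat.gr0I)
    with gap [of i c] i(1) show False by simp
  qed
  then have "s dvd i * k - x"
    using i(2) by (simp add: cong_altdef_nat)
  then obtain m where m: "i * k - x = m * s"
    by (metis dvdE mult.commute)
  have "i \<noteq> 0"
    using gap [of 0 0] le assms(2) by (auto intro!: Nat.gr0I)
  moreover have "m \<le> i * k div s"
    using m assms(2) by (metis diff_le_self less_eq_div_iff_mult_less_eq)
  moreover have "x = i * k - m * s"
    using m le by simp
  ultimately show "x \<in> ?f ` ?A"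
    using i(1) by (intro image_eqI [of _ _ "(i, m)"]) auto
next
  fix x assume "x \<in> ?f ` ?A"
  then obtain i m where i: "1 \<le> i" "i < s" and m: "m \<le> i * k div s" and x: "x = i * k - m * s"
    by auto
  have "m * s \<le> i * k"
    using m assms(2) by (simp add: less_eq_div_iff_mult_less_eq)
  then have x': "x + m * s = i * k"
    using x by simp
  have False if "j < s" "j = 0 \<or> c > 0" "x = c * s + j * k" for c j
  proof -
    have eq: "j * k + (c + m) * s = i * k"
      using x' that(3) by (simp add: algebra_simps)
    then have "[j * k = i * k] (mod s)"
      by (metis cong_def mod_mult_self1)
    then have "j = i"
      using multiples_cong_cancel assms(1) that(1) i(2) by blast
    with eq that(2) i(1) assms(2) show False by auto
  qed
  then show "x \<in> UNIV - ?T" by blast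
qed

text \<open>
  No two pairs give the same gap: the residue modulo \<open>s\<close> determines \<open>i\<close>. This needs \<open>m * s\<close> not
  to exceed \<open>i * k\<close>, as the subtraction would otherwise truncate.
\<close>

lemma inj_on_gaps_arith:
  fixes k s :: nat
  assumes "coprime s k" and "s > 0"
  shows "inj_on (\<lambda>(i, m). i * k - m * s) (SIGMA i:{1..<s}. {..i * k div s})"
proof (rule inj_onI, clarsimp)
  fix i m j n
  assume i: "i < s" "m \<le> i * k div s" and j: "j < s" "n \<le> j * k div s"
    and eq: "i * k - m * s = j * k - n * s"
  have "m * s \<le> i * k" "n * s \<le> j * k"
    using i j assms(2) by (simp_all add: less_eq_div_iff_mult_less_eq)
  with eq have eq': "i * k + n * s = j * k + m * s"
    by linarith
  then have "[i * k = j * k] (mod s)"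
    by (metis cong_def mod_mult_self1)
  then have "i = j"
    using multiples_cong_cancel assms(1) i(1) j(1) by blast
  with eq' assms(2) show "i = j \<and> m = n" by simp
qed

text \<open>
  The two dividends add up to \<open>s * k\<close>, and neither is a multiple of \<open>s\<close>; so their remainders
  add up to exactly \<open>s\<close>, which costs the quotients one unit.
\<close>

lemma floor_pair_sum:
  fixes i k s :: nat
  assumes "coprime s k" and "0 < i" and "i < s" and "k > 0"
  shows "i * k div s + (s - i) * k div s = k - 1"
proof -
  have "\<not> s dvd i * k"
    using assms by (simp add: coprime_dvd_mult_left_iff nat_dvd_not_less)
  define q where "q = i * k div s"
  define r where "r = i * k mod s"
  have ik: "i * k = q * s + r"
    by (simp add: q_def r_def)
  have r: "0 < r" "r < s"
    using \<open>\<not> s dvd i * k\<close> assms by (auto simp: r_def dvd_eq_mod_eq_0)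
  have "q < k"
    using assms unfolding q_def by (simp add: div_less_iff_less_mult mult.commute)
  then obtain p where p: "k = q + 1 + p"
    by (metis Suc_eq_plus1 add.commute add_Suc_right less_iff_Suc_add)
  have "s * k = q * s + s + p * s"
    by (simp add: p algebra_simps)
  then have "s * k - i * k = p * s + (s - r)"
    using ik r by linarith
  then have "(s - i) * k = p * s + (s - r)"
    by (simp only: diff_mult_distrib)
  moreover have "(p * s + (s - r)) div s = p"
    by (subst div_mult_self3) (use r in simp_all)
  ultimately have "(s - i) * k div s = p"
    by (simp only:)
  then show ?thesis
    using p unfolding q_def [symmetric] by linarith
qed

lemma twice_sum_floor:
  fixes k s :: nat
  assumes "coprime s k" and "k > 0"
  shows "2 * (\<Sum>i=1..<s. Suc (i * k div s)) = (s - 1) * (k + 1)"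
proof -
  have "(\<Sum>i=1..<s. Suc (i * k div s)) = (\<Sum>i=1..<s. Suc ((s - i) * k div s))"
    by (rule sum.reindex_bij_witness [of _ "\<lambda>i. s - i" "\<lambda>i. s - i"]) auto
  then have "2 * (\<Sum>i=1..<s. Suc (i * k div s))
      = (\<Sum>i=1..<s. Suc (i * k div s) + Suc ((s - i) * k div s))"
    by (simp only: sum.distrib mult_2)
  also have "\<dots> = (\<Sum>i=1..<s. k + 1)"
  proof (rule sum.cong)
    fix i assume "i \<in> {1..<s}"
    then show "Suc (i * k div s) + Suc ((s - i) * k div s) = k + 1"
      using floor_pair_sum [of s k i] assms by simp
  qed simp
  finally show ?thesis by simp
qed

theorem proposition3p7:
  fixes a k d s :: nat and S :: "nat set"
  assumes "a > 0" and "k > 0" and "coprime a k"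
    and "S = semigroup_gen a (\<lambda>i. a + i * k)"
    and "d > 0" and "a = s * d"
    and "semigroup_quotient S d \<noteq> UNIV"
  shows "real (genus (semigroup_quotient S d))
           = (real (frobenius (semigroup_quotient S d)) + real s - 1) / 2"
proof -
  have s: "s > 0" "coprime s k"
    using assms by auto
  let ?A = "SIGMA i:{1..<s}. {..i * k div s}"
  have "semigroup_quotient S d
      = {x. \<exists>c i. i < s \<and> (i = 0 \<or> c > 0) \<and> x = c * s + i * k}"
    using mem_semigroup_quotient_arith_iff [OF assms(1,3,5,6)] assms(4) by blast
  then have gaps: "UNIV - semigroup_quotient S d = (\<lambda>(i, m). i * k - m * s) ` ?A"
    using gaps_arith_eq [OF s(2,1)] by simp
  have "?A \<noteq> {}"
    using gaps assms(7) by auto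
  then have "s \<ge> 2"
    by auto
  have "genus (semigroup_quotient S d) = card ?A"
    unfolding genus_def gaps by (rule card_image [OF inj_on_gaps_arith [OF s(2,1)]])
  also have "\<dots> = (\<Sum>i=1..<s. Suc (i * k div s))"
    by simp
  finally have genus: "2 * genus (semigroup_quotient S d) = (s - 1) * (k + 1)"
    using twice_sum_floor [OF s(2) assms(2)] by simp
  have "frobenius (semigroup_quotient S d) = (s - 1) * k"
    unfolding frobenius_def gaps
  proof (rule Max_eqI)
    fix y assume "y \<in> (\<lambda>(i, m). i * k - m * s) ` ?A"
    then obtain i m where "i < s" "y = i * k - m * s" by auto
    then have "y \<le> i * k" "i * k \<le> (s - 1) * k"
      by (auto intro!: mult_le_mono1)
    then show "y \<le> (s - 1) * k" by (rule order_trans)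
  next
    show "(s - 1) * k \<in> (\<lambda>(i, m). i * k - m * s) ` ?A"
      using \<open>s \<ge> 2\<close> by (intro image_eqI [of _ _ "(s - 1, 0)"]) auto
  qed simp
  with genus \<open>s \<ge> 2\<close>
  have "2 * genus (semigroup_quotient S d) + 1 = frobenius (semigroup_quotient S d) + s"
    by (simp add: distrib_left)
  then have "2 * real (genus (semigroup_quotient S d)) + 1
      = real (frobenius (semigroup_quotient S d)) + real s"
    by (metis of_nat_1 of_nat_add of_nat_mult of_nat_numeral)
  then show ?thesis by simp
qed

end
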